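(* Let $\nu\ge 1$, suppose $y\sim\chi^2_\nu(\theta)$ (chi-squared with $\nu$ degrees of freedom and non-centrality parameter $\theta$), and consider a test of the null hypothesis $H_0:\theta=0$. Given an evidence threshold $\gamma>0$, let $\Lambda=\{(y,\theta): g(y,\theta)-\gamma=0\}$, where $g(y,\theta)$ is the likelihood ratio in favor of $\theta$ against $0$, and let $r:\Theta\to\mathbb{R}$ denote a function of $\theta$ such that $(r(\theta),\theta)\in\Lambda$. Then the alternative hypothesis that defines the UMPBT($\gamma$) is given by $H_1:\theta=\theta^*$, where $$\theta^*=\arg\min_{\theta>0} r(\theta).$$
   Context: For $\theta>0$ the density of $\chi^2_\nu(\theta)$ on $y>0$ is $$f(y\mid\theta)=\tfrac12\exp\!\left[-\tfrac{y+\theta}{2}\right]\left(\tfrac{y}{\theta}\right)^{\nu/4-1/2}I_{\nu/2-1}(\sqrt{\theta y}),\qquad I_\kappa(z)=\sum_{j=0}^\infty\frac{(z/2)^{2j+\kappa}}{\Gamma(\kappa+j+1)\,j!},$$ and for $\theta=0$ it is $f(y\mid 0)=2^{-\nu/2}e^{-y/2}y^{\nu/2-1}/\Gamma(\nu/2)$. The likelihood ratio is $$g(y,\theta)=\frac{f(y\mid\theta)}{f(y\mid 0)}=\Gamma\!\left(\tfrac{\nu}{2}\right)e^{-\theta/2}\,2^{\nu/2-1}(\sqrt{\theta y})^{1-\nu/2}I_{\nu/2-1}(\sqrt{\theta y}),\qquad y>0,\ \theta>0.$$ For each $\theta>0$, $g(\cdot,\theta)$ is strictly increasing in $y$, so there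 is at most one $y$ with $g(y,\theta)=\gamma$; $r(\theta)$ is that value of $y$. The parameter space for alternatives and data-generating parameters is $\Theta=(0,\infty)$. An alternative hypothesis $H_i:\theta\sim\pi_i$ is given by a prior probability distribution $\pi_i$ on $\Theta$ (point masses, i.e. simple alternatives, are allowed). The Bayes factor in favor of $H_i$ against $H_0:\theta=0$ is $\mathrm{BF}_{i0}(y)=\int_\Theta g(y,\theta)\,\pi_i(d\theta)$; for a simple alternative $H_1:\theta=\theta_1$ it equals $g(y,\theta_1)$. $\mathbf{P}_{\theta_t}$ denotes probability when $y\sim\chi^2_\nu(\theta_t)$. A uniformly most powerful Bayesian test for evidence threshold $\gamma>0$ in favor of $H_1$ against the fixed null $H_0$, denoted UMPBT($\gamma$), is a Bayesian hypothesis test whose Bayes factor satisfies, for every $\theta_t\in\Theta$ and every alternative hypothesis $H_2:\theta\sim\pi_2$, $$\mathbf{P}_{\theta_t}[\mathrm{BF}_{10}(y)>\gamma]\ge \mathbf{P}_{\theta_t}[\mathrm{BF}_{20}(y)>\gamma].$$ *)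

theory Defs
  imports "HOL-Probability.Probability"
begin

definition bessel_I :: "real \<Rightarrow> real \<Rightarrow> real" where
  "bessel_I \<kappa> z =
     (\<Sum>j. (z / 2) powr (2 * real j + \<kappa>) / (Gamma (\<kappa> + real j + 1) * fact j))"

definition ncx2_density :: "real \<Rightarrow> real \<Rightarrow> real \<Rightarrow> real" where
  "ncx2_density \<nu> \<theta> y =
     (if y \<le> 0 then 0
      else if \<theta> = 0 then 2 powr (- \<nu> / 2) * exp (- y / 2) * y powr (\<nu> / 2 - 1) / Gamma (\<nu> / 2)
      else 1 / 2 * exp (- (y + \<theta>) / 2) * (y / \<theta>) powr (\<nu> / 4 - 1 / 2)
             * bessel_I (\<nu> / 2 - 1) (sqrt (\<theta> * y)))"

definition ncx2 :: "real \<Rightarrow> real \<Rightarrow> real measure" where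
  "ncx2 \<nu> \<theta> = density lborel (\<lambda>y. ennreal (ncx2_density \<nu> \<theta> y))"

(* The closed form of this ratio on y > 0, theta > 0 is lemma lik_ratio_eq below;
   for y <= 0 (a null set of the sampling distributions) the value is 0 / 0 = 0. *)
definition lik_ratio :: "real \<Rightarrow> real \<Rightarrow> real \<Rightarrow> real" where
  "lik_ratio \<nu> y \<theta> = ncx2_density \<nu> \<theta> y / ncx2_density \<nu> 0 y"

definition level_set :: "real \<Rightarrow> real \<Rightarrow> (real \<times> real) set" where
  "level_set \<nu> \<gamma> = {(y, \<theta>). y > 0 \<and> \<theta> > 0 \<and> lik_ratio \<nu> y \<theta> - \<gamma> = 0}"

definition param_space :: "real measure" where
  "param_space = restrict_space borel {0<..}"

definition is_prior :: "real measure \<Rightarrow> bool" where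
  "is_prior \<pi> \<longleftrightarrow> prob_space \<pi> \<and> sets \<pi> = sets param_space"

definition simple_alt :: "real \<Rightarrow> real measure" where
  "simple_alt \<theta> = return param_space \<theta>"

definition bayes_factor :: "real \<Rightarrow> real measure \<Rightarrow> real \<Rightarrow> ennreal" where
  "bayes_factor \<nu> \<pi> y = (\<integral>\<^sup>+ \<theta>. ennreal (lik_ratio \<nu> y \<theta>) \<partial>\<pi>)"

definition exceed_prob :: "real \<Rightarrow> real \<Rightarrow> real measure \<Rightarrow> real \<Rightarrow> real" where
  "exceed_prob \<nu> \<gamma> \<pi> \<theta>\<^sub>t =
     measure (ncx2 \<nu> \<theta>\<^sub>t) {y \<in> space (ncx2 \<nu> \<theta>\<^sub>t). bayes_factor \<nu> \<pi> y > ennreal \<gamma>}"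

definition is_UMPBT :: "real \<Rightarrow> real \<Rightarrow> real measure \<Rightarrow> bool" where
  "is_UMPBT \<nu> \<gamma> \<pi>\<^sub>1 \<longleftrightarrow> is_prior \<pi>\<^sub>1 \<and>
     (\<forall>\<theta>\<^sub>t>0. \<forall>\<pi>\<^sub>2. is_prior \<pi>\<^sub>2 \<longrightarrow> exceed_prob \<nu> \<gamma> \<pi>\<^sub>1 \<theta>\<^sub>t \<ge> exceed_prob \<nu> \<gamma> \<pi>\<^sub>2 \<theta>\<^sub>t)"

lemma lik_ratio_eq:
  assumes "y > 0" "\<theta> > 0" "\<nu> > 0"
  shows "lik_ratio \<nu> y \<theta> = Gamma (\<nu> / 2) * exp (- \<theta> / 2) * 2 powr (\<nu> / 2 - 1)
           * sqrt (\<theta> * y) powr (1 - \<nu> / 2) * bessel_I (\<nu> / 2 - 1) (sqrt (\<theta> * y))"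
proof -
  have G: "Gamma (\<nu> / 2) > 0" using assms by simp
  have a: "y powr (\<nu> / 2 - 1) = y powr (\<nu> / 4 - 1 / 2) * y powr (\<nu> / 4 - 1 / 2)"
    by (simp flip: powr_add)
  have b: "sqrt (\<theta> * y) powr (1 - \<nu> / 2)
             = inverse (\<theta> powr (\<nu> / 4 - 1 / 2)) * inverse (y powr (\<nu> / 4 - 1 / 2))"
    using assms by (simp add: powr_half_sqrt[symmetric] powr_powr powr_mult
        powr_minus[symmetric] algebra_simps)
  have c: "(y / \<theta>) powr (\<nu> / 4 - 1 / 2) = y powr (\<nu> / 4 - 1 / 2) / \<theta> powr (\<nu> / 4 - 1 / 2)"
    using assms by (simp add: powr_divide)
  have d: "exp (- (y + \<theta>) / 2) = exp (- y / 2) * exp (- \<theta> / 2)"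
    by (simp flip: exp_add add: field_simps)
  have e: "2 powr (\<nu> / 2 - 1) = inverse (2 powr (- \<nu> / 2)) / (2::real)"
    by (simp add: powr_diff powr_minus[symmetric])
  show ?thesis
    unfolding lik_ratio_def ncx2_density_def a b c d e
    using assms G by (simp add: field_simps)
qed

lemma lik_ratio_measurable [measurable]:
  "(\<lambda>\<theta>. lik_ratio \<nu> y \<theta>) \<in> borel_measurable borel"
  unfolding lik_ratio_def ncx2_density_def bessel_I_def by measurable

lemma is_prior_simple_alt: "\<theta> > 0 \<Longrightarrow> is_prior (simple_alt \<theta>)"
  by (auto simp: is_prior_def simple_alt_def param_space_def space_restrict_space
      intro!: prob_space_return)

lemma bayes_factor_simple_alt:
  assumes "\<theta> > 0"
  shows "bayes_factor \<nu> (simple_alt \<theta>) y = ennreal (lik_ratio \<nu> y \<theta>)"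
proof -
  have "(\<lambda>\<theta>. ennreal (lik_ratio \<nu> y \<theta>)) \<in> borel_measurable param_space"
    unfolding param_space_def by (rule measurable_restrict_space1) measurable
  then show ?thesis
    using assms unfolding bayes_factor_def simple_alt_def
    by (subst nn_integral_return) (auto simp: param_space_def space_restrict_space)
qed

end

theory Submission imports Defs begin

text \<open>
  On \<open>y > 0\<close> the likelihood ratio is \<open>exp (- \<theta> / 2)\<close> times a power series in \<open>\<theta> y / 4\<close>
  with positive coefficients, so it is strictly increasing in \<open>y\<close>.  The simple alternative
  \<open>\<theta>\<close> therefore exceeds the evidence threshold \<open>\<gamma>\<close> exactly on the half-line
  \<open>y > r \<theta>\<close>, and the minimiser \<open>\<theta>star\<close> of \<open>r\<close> has the largest such half-line.

  Averaging over a prior cannot enlarge it: if \<open>y \<le> r \<theta>star\<close>, then \<open>y \<le> r \<theta>\<close> for every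
  \<open>\<theta> > 0\<close>, so every likelihood ratio at \<open>y\<close> is at most \<open>\<gamma>\<close>, and so is its mean under any
  probability distribution.  The rejection region of an arbitrary alternative is thus
  contained in that of \<open>\<theta>star\<close>, whatever the data-generating parameter is.

  Passing from this inclusion to probabilities requires the sampling distribution to be a
  finite measure, as the real-valued measure of a set of infinite measure is 0.  That it has
  total mass one follows by integrating the same power series term by term: the moments of
  the central chi-squared distribution turn it into the Poisson series.
\<close>

section \<open>The power series of the likelihood ratio\<close>

text \<open>
  This is the confluent hypergeometric limit function \<open>0F1(; a; x)\<close>.  It is entire in
  \<open>x\<close>, whereas the Bessel series it replaces carries a possibly singular power factor.
\<close>

definition hyper_0F1 :: "real \<Rightarrow> real \<Rightarrow> real" where
  "hyper_0F1 a x = (\<Sum>j. x ^ j / (pochhammer a j * fact j))"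

lemma power_le_pochhammer:
  fixes a :: real
  assumes "a > 0"
  shows "a ^ j \<le> pochhammer a j"
proof (induction j)
  case (Suc j)
  have "a ^ j * a \<le> pochhammer a j * (a + real j)"
    using Suc assms by (intro mult_mono) (auto intro: pochhammer_nonneg)
  then show ?case by (simp add: pochhammer_Suc mult.commute)
qed simp

text \<open>Since \<open>a ^ j \<le> pochhammer a j\<close>, the exponential series of \<open>x / a\<close> is a majorant.\<close>

lemma summable_hyper_0F1:
  fixes a x :: real
  assumes "a > 0"
  shows "summable (\<lambda>j. x ^ j / (pochhammer a j * fact j))"
proof (rule summable_comparison_test')
  show "summable (\<lambda>j. (\<bar>x\<bar> / a) ^ j / fact j)"
    using summable_exp[of "\<bar>x\<bar> / a"] by (simp add: field_simps)
  fix j :: nat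
  have p: "pochhammer a j > 0" using assms by (rule pochhammer_pos)
  have "norm (x ^ j / (pochhammer a j * fact j)) = \<bar>x\<bar> ^ j / (pochhammer a j * fact j)"
    using p by (simp add: power_abs abs_mult)
  also have "\<dots> \<le> \<bar>x\<bar> ^ j / (a ^ j * fact j)"
    using assms p by (intro divide_left_mono mult_right_mono power_le_pochhammer) auto
  also have "\<dots> = (\<bar>x\<bar> / a) ^ j / fact j"
    by (simp add: power_divide)
  finally show "norm (x ^ j / (pochhammer a j * fact j)) \<le> (\<bar>x\<bar> / a) ^ j / fact j" .
qed

lemma hyper_0F1_strict_mono:
  fixes a x y :: real
  assumes "a > 0" "0 \<le> x" "x < y"
  shows "hyper_0F1 a x < hyper_0F1 a y"
proof -
  let ?t = "\<lambda>x j. x ^ j / (pochhammer a j * fact j)"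
  have pos: "pochhammer a j > 0" for j using assms(1) by (rule pochhammer_pos)
  have "0 < (\<Sum>j. ?t y j - ?t x j)"
  proof (rule suminf_pos2[where i = 1])
    show "summable (\<lambda>j. ?t y j - ?t x j)"
      using assms(1) by (intro summable_diff summable_hyper_0F1)
    show "0 \<le> ?t y j - ?t x j" for j
      using assms pos[of j] by (simp add: divide_right_mono power_mono less_imp_le)
    show "0 < ?t y 1 - ?t x 1"
      using assms by (simp add: divide_strict_right_mono)
  qed
  also have "\<dots> = hyper_0F1 a y - hyper_0F1 a x"
    unfolding hyper_0F1_def
    using suminf_diff[OF summable_hyper_0F1[OF assms(1)] summable_hyper_0F1[OF assms(1)]]
    by simp
  finally show ?thesis by simp
qed

lemma bessel_I_eq_hyper_0F1:
  assumes "\<kappa> > -1" "z > 0"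
  shows "bessel_I \<kappa> z = (z / 2) powr \<kappa> / Gamma (\<kappa> + 1) * hyper_0F1 (\<kappa> + 1) (z\<^sup>2 / 4)"
proof -
  have "(z / 2) powr (2 * real j + \<kappa>) / (Gamma (\<kappa> + real j + 1) * fact j)
      = (z / 2) powr \<kappa> / Gamma (\<kappa> + 1) * ((z\<^sup>2 / 4) ^ j / (pochhammer (\<kappa> + 1) j * fact j))" for j
  proof -
    have "pochhammer (\<kappa> + 1) j = Gamma (\<kappa> + 1 + real j) / Gamma (\<kappa> + 1)"
      using assms by (intro pochhammer_Gamma) (auto elim!: nonpos_Ints_cases)
    moreover have "Gamma (\<kappa> + 1) > 0" using assms by simp
    ultimately have G: "Gamma (\<kappa> + real j + 1) = Gamma (\<kappa> + 1) * pochhammer (\<kappa> + 1) j"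
      by (simp add: add_ac)
    have "(z / 2) powr (2 * real j) = (z / 2) ^ (2 * j)"
      using assms powr_realpow[of "z / 2" "2 * j"] by simp
    also have "\<dots> = (z\<^sup>2 / 4) ^ j"
      by (simp add: power_mult power_divide)
    finally show ?thesis
      unfolding G by (simp add: powr_add mult_ac)
  qed
  then show ?thesis
    unfolding bessel_I_def hyper_0F1_def
    using assms by (simp only: suminf_mult[OF summable_hyper_0F1])
qed

lemma lik_ratio_eq_hyper_0F1:
  assumes "y > 0" "\<theta> > 0" "\<nu> > 0"
  shows "lik_ratio \<nu> y \<theta> = exp (- \<theta> / 2) * hyper_0F1 (\<nu> / 2) (\<theta> * y / 4)"
proof -
  let ?s = "sqrt (\<theta> * y)"
  have s: "?s > 0" and s2: "?s\<^sup>2 = \<theta> * y" using assms by simp_all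
  have G: "Gamma (\<nu> / 2) > 0" using assms by simp
  have "?s powr (1 - \<nu> / 2) * ?s powr (\<nu> / 2 - 1) = 1"
    using assms by (simp flip: powr_add)
  moreover have "(?s / 2) powr (\<nu> / 2 - 1) = ?s powr (\<nu> / 2 - 1) / 2 powr (\<nu> / 2 - 1)"
    using s by (simp only: powr_divide)
  ultimately have cancel:
    "2 powr (\<nu> / 2 - 1) * ?s powr (1 - \<nu> / 2) * (?s / 2) powr (\<nu> / 2 - 1) = 1"
    by simp
  have bessel: "bessel_I (\<nu> / 2 - 1) ?s
      = (?s / 2) powr (\<nu> / 2 - 1) / Gamma (\<nu> / 2) * hyper_0F1 (\<nu> / 2) (\<theta> * y / 4)"
    using bessel_I_eq_hyper_0F1[of "\<nu> / 2 - 1" ?s] assms(3) s s2 by simp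
  have "lik_ratio \<nu> y \<theta> = exp (- \<theta> / 2) * hyper_0F1 (\<nu> / 2) (\<theta> * y / 4)
      * (2 powr (\<nu> / 2 - 1) * ?s powr (1 - \<nu> / 2) * (?s / 2) powr (\<nu> / 2 - 1))"
    unfolding lik_ratio_eq[OF assms] bessel using G by simp
  then show ?thesis unfolding cancel by simp
qed

lemma lik_ratio_strict_mono:
  assumes "0 < x" "x < y" "\<theta> > 0" "\<nu> > 0"
  shows "lik_ratio \<nu> x \<theta> < lik_ratio \<nu> y \<theta>"
  using assms hyper_0F1_strict_mono[of "\<nu> / 2" "\<theta> * x / 4" "\<theta> * y / 4"]
  by (simp add: lik_ratio_eq_hyper_0F1)

lemma lik_ratio_nonpos_eq_0: "y \<le> 0 \<Longrightarrow> lik_ratio \<nu> y \<theta> = 0"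
  by (simp add: lik_ratio_def ncx2_density_def)

section \<open>The noncentral chi-squared distribution has total mass one\<close>

lemma ncx2_density_measurable [measurable]: "ncx2_density \<nu> \<theta> \<in> borel_measurable borel"
proof -
  have "(\<lambda>y. ncx2_density \<nu> \<theta> y) \<in> borel_measurable borel"
    unfolding ncx2_density_def bessel_I_def by measurable
  then show ?thesis by simp
qed

text \<open>The substitution \<open>y = 2 t\<close> reduces these moments to Euler's integral for Gamma.\<close>

lemma nn_integral_central_moment:
  assumes "\<nu> > 0"
  shows "(\<integral>\<^sup>+ y. ennreal (ncx2_density \<nu> 0 y * y ^ j) \<partial>lborel)
      = ennreal (2 ^ j * pochhammer (\<nu> / 2) j)"
proof -
  define a where "a = \<nu> / 2"
  have a: "a > 0" and G: "Gamma a > 0" using assms by (simp_all add: a_def)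
  have subst: "2 * (ncx2_density \<nu> 0 (2 * t) * (2 * t) ^ j)
      = 2 ^ j / Gamma a * (indicator {0..} t * t powr (a + real j - 1) / exp t)" for t
  proof (cases "t > 0")
    case True
    have 1: "(2 * t) powr (a - 1) = 2 powr (a - 1) * t powr (a - 1)"
      using True by (simp add: powr_mult)
    have 2: "2 * (2 powr (- a) * 2 powr (a - 1)) = (1 :: real)"
      by (simp add: powr_minus powr_diff)
    have 3: "t powr (a + real j - 1) = t powr (a - 1) * t ^ j"
      using True powr_realpow[OF True, of j] by (simp add: powr_add powr_diff)
    have "2 * (ncx2_density \<nu> 0 (2 * t) * (2 * t) ^ j)
        = (2 * (2 powr (- a) * 2 powr (a - 1))) * (t powr (a - 1) * t ^ j) * 2 ^ j * exp (- t) / Gamma a"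
      using True by (simp add: ncx2_density_def a_def[symmetric] 1 power_mult_distrib)
    also have "\<dots> = 2 ^ j / Gamma a * (indicator {0..} t * t powr (a + real j - 1) / exp t)"
      unfolding 2 3 using True by (simp add: exp_minus field_simps)
    finally show ?thesis .
  next
    case False
    then show ?thesis by (cases "t = 0") (auto simp: ncx2_density_def indicator_def)
  qed
  have "(\<integral>\<^sup>+ y. ennreal (ncx2_density \<nu> 0 y * y ^ j) \<partial>lborel)
      = (\<integral>\<^sup>+ t. ennreal 2 * ennreal (ncx2_density \<nu> 0 (2 * t) * (2 * t) ^ j) \<partial>lborel)"
    by (subst nn_integral_real_affine[where c = 2 and t = 0]) (auto simp: nn_integral_cmult)
  also have "\<dots> = (\<integral>\<^sup>+ t. ennreal (2 ^ j / Gamma a)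
      * ennreal (indicator {0..} t * t powr (a + real j - 1) / exp t) \<partial>lborel)"
    using G by (intro nn_integral_cong) (simp only: ennreal_mult'[symmetric] subst
        zero_le_numeral zero_le_divide_iff zero_le_power less_imp_le simp_thms)
  also have "\<dots> = ennreal (2 ^ j / Gamma a)
      * (\<integral>\<^sup>+ t. ennreal (indicator {0..} t * t powr (a + real j - 1) / exp t) \<partial>lborel)"
    by (rule nn_integral_cmult) measurable
  also have "\<dots> = ennreal (2 ^ j / Gamma a) * ennreal (Gamma (a + real j))"
    using a Gamma_conv_nn_integral_real[of "a + real j"] by simp
  also have "\<dots> = ennreal (2 ^ j * (Gamma (a + real j) / Gamma a))"
    using G by (simp add: ennreal_mult'[symmetric])
  also have "Gamma (a + real j) / Gamma a = pochhammer a j"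
    using a by (intro pochhammer_Gamma[symmetric]) (auto elim!: nonpos_Ints_cases)
  finally show ?thesis by (simp add: a_def)
qed

text \<open>
  The density is a power series in \<open>y\<close> times the central density.  The Pochhammer symbols
  in its coefficients cancel against those in the central moments, which leaves the
  Poisson weights with mean \<open>\<theta> / 2\<close>.
\<close>

lemma prob_space_ncx2:
  assumes "\<nu> > 0" "\<theta> > 0"
  shows "prob_space (ncx2 \<nu> \<theta>)"
proof
  define c where "c j = exp (- \<theta> / 2) * (\<theta> / 4) ^ j / (pochhammer (\<nu> / 2) j * fact j)" for j
  have p: "pochhammer (\<nu> / 2) j > 0" for j using assms by (intro pochhammer_pos) simp
  have c0: "c j \<ge> 0" for j using assms p[of j] by (simp add: c_def)
  have dens: "ennreal (ncx2_density \<nu> \<theta> y)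
      = (\<Sum>j. ennreal (c j) * ennreal (ncx2_density \<nu> 0 y * y ^ j))" for y
  proof (cases "y > 0")
    case True
    have f0: "ncx2_density \<nu> 0 y > 0" using True assms by (simp add: ncx2_density_def)
    let ?t = "\<lambda>j. (\<theta> * y / 4) ^ j / (pochhammer (\<nu> / 2) j * fact j)"
    let ?m = "ncx2_density \<nu> 0 y * exp (- \<theta> / 2)"
    have "ncx2_density \<nu> \<theta> y = ncx2_density \<nu> 0 y * lik_ratio \<nu> y \<theta>"
      using f0 by (simp add: lik_ratio_def)
    also have "\<dots> = ?m * hyper_0F1 (\<nu> / 2) (\<theta> * y / 4)"
      using True assms by (simp add: lik_ratio_eq_hyper_0F1)
    finally have eq: "ncx2_density \<nu> \<theta> y = ?m * (\<Sum>j. ?t j)" by (simp only: hyper_0F1_def)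
    have sm: "summable ?t" using assms by (intro summable_hyper_0F1) simp
    have t: "c j * (ncx2_density \<nu> 0 y * y ^ j) = ?m * ?t j" for j
      by (simp add: c_def power_mult_distrib power_divide)
    have "(\<Sum>j. ennreal (c j) * ennreal (ncx2_density \<nu> 0 y * y ^ j)) = (\<Sum>j. ennreal (?m * ?t j))"
      using c0 by (simp only: ennreal_mult'[symmetric] t)
    also have "\<dots> = ennreal (\<Sum>j. ?m * ?t j)"
    proof (rule suminf_ennreal2)
      show "0 \<le> ?m * ?t j" for j using f0 True assms p[of j] by simp
      show "summable (\<lambda>j. ?m * ?t j)" using sm by (rule summable_mult)
    qed
    also have "\<dots> = ennreal (ncx2_density \<nu> \<theta> y)"
      using suminf_mult[OF sm] eq by simp
    finally show ?thesis ..
  next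
    case False
    then show ?thesis by (simp add: ncx2_density_def)
  qed
  have poisson: "c j * (2 ^ j * pochhammer (\<nu> / 2) j) = exp (- \<theta> / 2) * ((\<theta> / 2) ^ j / fact j)" for j
  proof -
    have "(\<theta> / 4) ^ j * 2 ^ j = (\<theta> / 2) ^ j" by (simp flip: power_mult_distrib)
    then show ?thesis using p[of j] by (simp add: c_def)
  qed
  have sums: "(\<lambda>j. exp (- \<theta> / 2) * ((\<theta> / 2) ^ j / fact j)) sums 1"
    using sums_mult[OF exp_converges[of "\<theta> / 2"], of "exp (- \<theta> / 2)"]
    by (simp add: exp_minus field_simps)
  have "emeasure (ncx2 \<nu> \<theta>) (space (ncx2 \<nu> \<theta>)) = (\<integral>\<^sup>+ y. ennreal (ncx2_density \<nu> \<theta> y) \<partial>lborel)"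
    by (simp add: ncx2_def emeasure_density)
  also have "\<dots> = (\<Sum>j. \<integral>\<^sup>+ y. ennreal (c j) * ennreal (ncx2_density \<nu> 0 y * y ^ j) \<partial>lborel)"
    unfolding dens by (rule nn_integral_suminf) measurable
  also have "\<dots> = (\<Sum>j. ennreal (c j) * ennreal (2 ^ j * pochhammer (\<nu> / 2) j))"
    using assms by (simp add: nn_integral_cmult nn_integral_central_moment)
  also have "\<dots> = (\<Sum>j. ennreal (exp (- \<theta> / 2) * ((\<theta> / 2) ^ j / fact j)))"
    using c0 by (simp only: ennreal_mult'[symmetric] poisson)
  also have "\<dots> = ennreal (\<Sum>j. exp (- \<theta> / 2) * ((\<theta> / 2) ^ j / fact j))"
    using assms sums by (intro suminf_ennreal2) (auto simp: sums_iff)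
  also have "\<dots> = 1" using sums by (simp add: sums_iff)
  finally show "emeasure (ncx2 \<nu> \<theta>) (space (ncx2 \<nu> \<theta>)) = 1" .
qed

section \<open>Averaging over a prior and the optimal alternative\<close>

lemma bayes_factor_le:
  assumes "is_prior \<pi>" and le: "\<And>\<theta>. \<theta> > 0 \<Longrightarrow> lik_ratio \<nu> y \<theta> \<le> \<gamma>"
  shows "bayes_factor \<nu> \<pi> y \<le> ennreal \<gamma>"
proof -
  interpret prob_space \<pi> using assms(1) by (simp add: is_prior_def)
  have "space \<pi> = {0<..}"
    using assms(1) sets_eq_imp_space_eq[of \<pi> param_space]
    by (simp add: is_prior_def param_space_def space_restrict_space)
  then have "bayes_factor \<nu> \<pi> y \<le> (\<integral>\<^sup>+ \<theta>. ennreal \<gamma> \<partial>\<pi>)"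
    unfolding bayes_factor_def by (intro nn_integral_mono) (auto intro: ennreal_leI le)
  then show ?thesis by (simp add: emeasure_space_1)
qed

theorem corollary2:
  fixes \<nu> \<gamma> \<theta>star :: real and r :: "real \<Rightarrow> real"
  assumes "\<nu> \<ge> 1"
    and "\<gamma> > 0"
    and "\<And>\<theta>. \<theta> > 0 \<Longrightarrow> (r \<theta>, \<theta>) \<in> level_set \<nu> \<gamma>"
    and "is_arg_min r (\<lambda>\<theta>. \<theta> > 0) \<theta>star"
  shows "is_UMPBT \<nu> \<gamma> (simple_alt \<theta>star)"
proof -
  have \<nu>: "\<nu> > 0" using assms(1) by simp
  have star: "\<theta>star > 0" and min: "\<theta> > 0 \<Longrightarrow> r \<theta>star \<le> r \<theta>" for \<theta>
    using assms(4) unfolding is_arg_min_def by (blast, meson not_less)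
  have r: "r \<theta> > 0" "lik_ratio \<nu> (r \<theta>) \<theta> = \<gamma>" if "\<theta> > 0" for \<theta>
    using assms(3)[OF that] by (auto simp: level_set_def)
  have reject: "{y. bayes_factor \<nu> (simple_alt \<theta>star) y > ennreal \<gamma>} \<supseteq> {r \<theta>star<..}"
  proof
    fix y assume "y \<in> {r \<theta>star<..}"
    then have "\<gamma> < lik_ratio \<nu> y \<theta>star"
      using r[OF star] lik_ratio_strict_mono[of "r \<theta>star" y] star \<nu> by auto
    then show "y \<in> {y. bayes_factor \<nu> (simple_alt \<theta>star) y > ennreal \<gamma>}"
      using assms(2) star by (simp add: bayes_factor_simple_alt ennreal_lessI)
  qed
  have accept: "bayes_factor \<nu> \<pi> y \<le> ennreal \<gamma>" if "is_prior \<pi>" "y \<le> r \<theta>star" for \<pi> y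
  proof (rule bayes_factor_le[OF that(1)])
    fix \<theta> :: real assume \<theta>: "\<theta> > 0"
    show "lik_ratio \<nu> y \<theta> \<le> \<gamma>"
    proof (cases "y > 0")
      case True
      have "y \<le> r \<theta>" using that(2) min[OF \<theta>] by simp
      then show ?thesis
        using lik_ratio_strict_mono[of y "r \<theta>" \<theta> \<nu>] r[OF \<theta>] True \<theta> \<nu> by (cases "y = r \<theta>") auto
    next
      case False
      \<comment> \<open>Both densities vanish here, so the ratio has its default value 0, below \<open>\<gamma>\<close>.\<close>
      then show ?thesis using assms(2) by (simp add: lik_ratio_nonpos_eq_0)
    qed
  qed
  have region: "{y. bayes_factor \<nu> (simple_alt \<theta>star) y > ennreal \<gamma>} = {r \<theta>star<..}"
    using reject accept[OF is_prior_simple_alt[OF star]] by (force simp: not_less[symmetric])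
  have "exceed_prob \<nu> \<gamma> \<pi> \<theta> \<le> exceed_prob \<nu> \<gamma> (simple_alt \<theta>star) \<theta>"
    if "\<theta> > 0" "is_prior \<pi>" for \<theta> \<pi>
  proof -
    interpret prob_space "ncx2 \<nu> \<theta>" using prob_space_ncx2[OF \<nu> that(1)] .
    have "{y. bayes_factor \<nu> \<pi> y > ennreal \<gamma>} \<subseteq> {r \<theta>star<..}"
      using accept[OF that(2)] by (force simp: not_less[symmetric])
    then show ?thesis
      unfolding exceed_prob_def
      using finite_measure_mono[of _ "{r \<theta>star<..}"] by (simp add: ncx2_def region)
  qed
  then show ?thesis
    using is_prior_simple_alt[OF star] by (simp add: is_UMPBT_def)
qed

end
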